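(* Let $\delta=hD_{\mathbb{V}}$, where $h\in\mathbb{K}[y_2,\dots,y_m]$, and let $\theta\in\mathbb{G}$ be given by $$\theta(y_2,\dots,y_m,z)=(t_2y_{\sigma(2)},\dots,t_my_{\sigma(m)},t_{m+1}z),$$ where $\sigma\in S(\mathbb{V})$ and $(t_2,\dots,t_{m+1})\in(\mathbb{K}^* )^m$. Then the following statements are equivalent. (a) $\delta\theta(y_1)=\theta\delta(y_1)$. (b) $t_{m+1}h=\theta(h)\prod_{j=2}^{m}t_j^{k_j}$. (c) $\delta\theta(z)=\theta\delta(z)$. (d) $\theta\in\mathrm{Aut}(\delta)$. Moreover, if $\theta(h)=h$ (in particular, when $h\in\mathbb{K}^*$), statement (b) is equivalent to (b)$'$ $t_{m+1}=\prod_{j=2}^{m}t_j^{k_j}$.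
   Context: $\mathbb{K}$ is an algebraically closed field of characteristic zero; $d,m,k_2,\dots,k_m$ are integers $\geqslant 2$. A Danielewski variety $\mathbb{V}\subseteq\mathbb{K}^{m+1}$ is an affine variety with coordinate ring $$\mathbb{K}[\mathbb{V}]=\mathbb{K}[Y_1,\dots,Y_m,Z]/(Y_1Y_2^{k_2}\cdots Y_m^{k_m}-P(Y_2,\dots,Y_m,Z)),$$ where $P=Z^d+s_{d-1}(Y_2,\dots,Y_m)Z^{d-1}+\dots+s_0(Y_2,\dots,Y_m)$; by a suitable change of coordinates one may assume, and it is assumed, that $s_{d-1}=0$. Let $y_1,\dots,y_m,z$ be the images of $Y_1,\dots,Y_m,Z$. The canonical locally nilpotent derivation $D_{\mathbb{V}}$ is the $\mathbb{K}$-derivation with $D_{\mathbb{V}}(y_1)=\frac{\partial P}{\partial z}$, $D_{\mathbb{V}}(z)=y_2^{k_2}\cdots y_m^{k_m}$, $D_{\mathbb{V}}(y_i)=0$ for $i\geqslant 2$. Let $S(\mathbb{V})$ be the group of permutations $\sigma$ of $\{2,\dots,m\}$ stabilizing the monomial $Y_2^{k_2}\cdots Y_m^{k_m}$ (permuting the indices $i$ with equal $k_i$). The semidirect product $G=S(\mathbb{V})\ltimes(\mathbb{K}^* )^m$ acts on the field $\mathbb{K}(y_2,\dots,y_m,z)$ by $(\sigma,t_2,\dots,t_{m+1})\cdot(y_2,\dots,y_m,z)=(t_2y_{\sigma(2)},\dots,t_my_{\sigma(m)},t_{m+1}z)$. The ring $\mathbb{K}[\mathbb{V}]$ embeds in this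 field via $y_1\mapsto P(y_2,\dots,y_m,z)/(y_2^{k_2}\cdots y_m^{k_m})$. The canonical group $\mathbb{G}\subseteq G$ is the stabilizer of the image of $\mathbb{K}[\mathbb{V}]$; it acts on $\mathbb{K}[\mathbb{V}]$, and the corresponding group of $\mathbb{K}$-algebra automorphisms of $\mathbb{K}[\mathbb{V}]$ is also denoted $\mathbb{G}$. $\mathrm{Aut}(\delta)$ is the group of $\mathbb{K}$-algebra automorphisms of $\mathbb{K}[\mathbb{V}]$ commuting with $\delta$.
   Formalization: In the "moreover" part the formal statement also assumes h ≠ 0; for h = 0 statement (b) holds trivially while (b)' can fail (e.g. P = Z^d, t_{m+1} = 2, all other t_j = 1). *)

theory Defs
  imports
    "HOL-Library.Poly_Mapping"
    "HOL-Computational_Algebra.Polynomial"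
    "HOL-Computational_Algebra.Fraction_Field"
    "HOL-Combinatorics.Permutations"
    "HOL-Algebra.QuotRing"
begin

section \<open>Multivariate polynomials and rational functions\<close>

text \<open>
  Polynomials in countably many variables, as finitely supported maps from exponent vectors to
  coefficients. The variables \<open>1, \<dots>, m\<close> stand for \<open>Y\<^sub>1, \<dots>, Y\<^sub>m\<close> and the variable \<open>Suc m\<close> stands for \<open>Z\<close>;
  polynomial rings in finitely many of these variables are cut out by \<open>mpolys\<close> below.
\<close>

type_synonym 'k mpoly = "(nat \<Rightarrow>\<^sub>0 nat) \<Rightarrow>\<^sub>0 'k"

definition mconst :: "'k::comm_ring_1 \<Rightarrow> 'k mpoly" where
  "mconst c = Poly_Mapping.single 0 c"

definition mvar :: "nat \<Rightarrow> 'k::comm_ring_1 mpoly" where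
  "mvar i = Poly_Mapping.single (Poly_Mapping.single i 1) 1"

definition mpolys :: "nat set \<Rightarrow> 'k::comm_ring_1 mpoly set" where
  "mpolys V = {p. \<forall>e \<in> Poly_Mapping.keys p. Poly_Mapping.keys e \<subseteq> V}"

definition mpoly_ring :: "nat set \<Rightarrow> 'k::comm_ring_1 mpoly ring" where
  "mpoly_ring V = \<lparr>carrier = mpolys V, mult = (*), one = 1, zero = 0, add = (+)\<rparr>"

text \<open>Formal partial derivative with respect to the variable \<open>i\<close>. Terms free of \<open>i\<close> contribute \<open>0\<close>,
  so the truncated subtraction of exponents is harmless.\<close>

definition mpderiv :: "nat \<Rightarrow> 'k::comm_ring_1 mpoly \<Rightarrow> 'k mpoly" where
  "mpderiv i p = (\<Sum>e \<in> Poly_Mapping.keys p.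
     Poly_Mapping.single (e - Poly_Mapping.single i 1)
       (of_nat (Poly_Mapping.lookup e i) * Poly_Mapping.lookup p e))"

definition mfrac :: "'k::field mpoly \<Rightarrow> 'k mpoly fract" where
  "mfrac p = Fraction_Field.Fract p 1"

text \<open>Substitution of the rational functions \<open>x i\<close> for the variables \<open>i\<close>.\<close>

definition msubst :: "(nat \<Rightarrow> 'k::field mpoly fract) \<Rightarrow> 'k mpoly \<Rightarrow> 'k mpoly fract" where
  "msubst x p = (\<Sum>e \<in> Poly_Mapping.keys p.
     mfrac (mconst (Poly_Mapping.lookup p e)) *
     (\<Prod>i \<in> Poly_Mapping.keys e. x i ^ Poly_Mapping.lookup e i))"


section \<open>Danielewski varieties\<close>

definition dan_monom :: "nat \<Rightarrow> (nat \<Rightarrow> nat) \<Rightarrow> 'k::field mpoly" where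
  "dan_monom m k = (\<Prod>i = 2..m. mvar i ^ k i)"

definition dan_poly :: "nat \<Rightarrow> nat \<Rightarrow> (nat \<Rightarrow> 'k::field mpoly) \<Rightarrow> 'k mpoly" where
  "dan_poly d m s = mvar (Suc m) ^ d + (\<Sum>j<d. s j * mvar (Suc m) ^ j)"

definition dan_ideal :: "nat \<Rightarrow> (nat \<Rightarrow> nat) \<Rightarrow> 'k::field mpoly \<Rightarrow> 'k mpoly set" where
  "dan_ideal m k P = PIdl\<^bsub>mpoly_ring {1..Suc m}\<^esub> (mvar 1 * dan_monom m k - P)"

text \<open>The coordinate ring \<open>\<bbbK>[\<V>]\<close>, the projection onto it, and its scalars.\<close>

definition dan_ring :: "nat \<Rightarrow> (nat \<Rightarrow> nat) \<Rightarrow> 'k::field mpoly \<Rightarrow> 'k mpoly set ring" where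
  "dan_ring m k P = mpoly_ring {1..Suc m} Quot dan_ideal m k P"

definition dan_class :: "nat \<Rightarrow> (nat \<Rightarrow> nat) \<Rightarrow> 'k::field mpoly \<Rightarrow> 'k mpoly \<Rightarrow> 'k mpoly set" where
  "dan_class m k P p = dan_ideal m k P +>\<^bsub>mpoly_ring {1..Suc m}\<^esub> p"

definition dan_scalar :: "nat \<Rightarrow> (nat \<Rightarrow> nat) \<Rightarrow> 'k::field mpoly \<Rightarrow> 'k \<Rightarrow> 'k mpoly set" where
  "dan_scalar m k P c = dan_class m k P (mconst c)"

definition is_derivation :: "('a, 'b) ring_scheme \<Rightarrow> ('k \<Rightarrow> 'a) \<Rightarrow> ('a \<Rightarrow> 'a) \<Rightarrow> bool" where
  "is_derivation A \<kappa> D \<longleftrightarrow>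
     D \<in> carrier A \<rightarrow> carrier A \<and>
     (\<forall>a \<in> carrier A. \<forall>b \<in> carrier A. D (a \<oplus>\<^bsub>A\<^esub> b) = D a \<oplus>\<^bsub>A\<^esub> D b) \<and>
     (\<forall>a \<in> carrier A. \<forall>b \<in> carrier A.
        D (a \<otimes>\<^bsub>A\<^esub> b) = (D a \<otimes>\<^bsub>A\<^esub> b) \<oplus>\<^bsub>A\<^esub> (a \<otimes>\<^bsub>A\<^esub> D b)) \<and>
     (\<forall>c. \<forall>a \<in> carrier A. D (\<kappa> c \<otimes>\<^bsub>A\<^esub> a) = \<kappa> c \<otimes>\<^bsub>A\<^esub> D a)"

text \<open>\<open>D\<close> is the canonical locally nilpotent derivation \<open>D\<^sub>\<V>\<close>; the conditions determine it on \<open>\<bbbK>[\<V>]\<close>.\<close>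

definition is_canonical_derivation ::
  "nat \<Rightarrow> (nat \<Rightarrow> nat) \<Rightarrow> 'k::field mpoly \<Rightarrow> ('k mpoly set \<Rightarrow> 'k mpoly set) \<Rightarrow> bool" where
  "is_canonical_derivation m k P D \<longleftrightarrow>
     is_derivation (dan_ring m k P) (dan_scalar m k P) D \<and>
     D (dan_class m k P (mvar 1)) = dan_class m k P (mpderiv (Suc m) P) \<and>
     D (dan_class m k P (mvar (Suc m))) = dan_class m k P (dan_monom m k) \<and>
     (\<forall>i \<in> {2..m}. D (dan_class m k P (mvar i)) = dan_class m k P 0)"

definition alg_auts :: "('a, 'b) ring_scheme \<Rightarrow> ('k \<Rightarrow> 'a) \<Rightarrow> ('a \<Rightarrow> 'a) set" where
  "alg_auts A \<kappa> = {\<phi> \<in> ring_iso A A \<inter> extensional (carrier A). \<forall>c. \<phi> (\<kappa> c) = \<kappa> c}"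

definition derivation_auts ::
  "('a, 'b) ring_scheme \<Rightarrow> ('k \<Rightarrow> 'a) \<Rightarrow> ('a \<Rightarrow> 'a) \<Rightarrow> ('a \<Rightarrow> 'a) set" where
  "derivation_auts A \<kappa> \<delta> = {\<phi> \<in> alg_auts A \<kappa>. \<forall>a \<in> carrier A. \<phi> (\<delta> a) = \<delta> (\<phi> a)}"


section \<open>The canonical group\<close>

text \<open>The embedding of \<open>\<bbbK>[\<V>]\<close> into \<open>\<bbbK>(y\<^sub>2, \<dots>, y\<^sub>m, z)\<close>: substitute
  \<open>P / (y\<^sub>2^k\<^sub>2 \<cdots> y\<^sub>m^k\<^sub>m)\<close> for \<open>Y\<^sub>1\<close> in any representative.\<close>

definition dan_embed ::
  "nat \<Rightarrow> (nat \<Rightarrow> nat) \<Rightarrow> 'k::field mpoly \<Rightarrow> 'k mpoly set \<Rightarrow> 'k mpoly fract" where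
  "dan_embed m k P a =
     the_elem (msubst (\<lambda>i. if i = 1 then mfrac P / mfrac (dan_monom m k) else mfrac (mvar i)) ` a)"

definition monom_perms :: "'k::field itself \<Rightarrow> nat \<Rightarrow> (nat \<Rightarrow> nat) \<Rightarrow> (nat \<Rightarrow> nat) set" where
  "monom_perms _ m k = {\<sigma>. \<sigma> permutes {2..m} \<and>
     (\<Prod>i = 2..m. (mvar (\<sigma> i) :: 'k mpoly) ^ k i) = dan_monom m k}"

text \<open>The group \<open>G\<close>, as the set of its elements \<open>(\<sigma>, t)\<close> with \<open>t = (t\<^sub>2, \<dots>, t\<^sub>m\<^sub>+\<^sub>1)\<close>.\<close>

definition semidirect_group :: "nat \<Rightarrow> (nat \<Rightarrow> nat) \<Rightarrow> ((nat \<Rightarrow> nat) \<times> (nat \<Rightarrow> 'k::field)) set" where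
  "semidirect_group m k =
     monom_perms TYPE('k) m k \<times> ({2..Suc m} \<rightarrow>\<^sub>E (UNIV - {0}))"

text \<open>The action of \<open>(\<sigma>, t)\<close> on a rational function \<open>r\<close> in \<open>y\<^sub>2, \<dots>, y\<^sub>m, z\<close>, by substitution in
  the numerator and denominator of any representation of \<open>r\<close> as a fraction.\<close>

definition field_action ::
  "nat \<Rightarrow> (nat \<Rightarrow> nat) \<times> (nat \<Rightarrow> 'k::field) \<Rightarrow> 'k mpoly fract \<Rightarrow> 'k mpoly fract" where
  "field_action m = (\<lambda>(\<sigma>, t) r.
     let x = (\<lambda>i. mfrac (mconst (t i) * mvar (if i = Suc m then Suc m else \<sigma> i)))
     in THE r'. \<exists>a \<in> mpolys {2..Suc m}. \<exists>b \<in> mpolys {2..Suc m} - {0}.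
          r = Fraction_Field.Fract a b \<and> r' = msubst x a / msubst x b)"

definition canonical_group ::
  "nat \<Rightarrow> (nat \<Rightarrow> nat) \<Rightarrow> 'k::field mpoly \<Rightarrow> ((nat \<Rightarrow> nat) \<times> (nat \<Rightarrow> 'k)) set" where
  "canonical_group m k P = {g \<in> semidirect_group m k.
     field_action m g ` (dan_embed m k P ` carrier (dan_ring m k P)) =
       dan_embed m k P ` carrier (dan_ring m k P)}"

text \<open>The automorphism of \<open>\<bbbK>[\<V>]\<close> given by an element of the canonical group.\<close>

definition canonical_aut ::
  "nat \<Rightarrow> (nat \<Rightarrow> nat) \<Rightarrow> 'k::field mpoly \<Rightarrow> (nat \<Rightarrow> nat) \<times> (nat \<Rightarrow> 'k) \<Rightarrow>
    'k mpoly set \<Rightarrow> 'k mpoly set" where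
  "canonical_aut m k P g = (\<lambda>a \<in> carrier (dan_ring m k P).
     inv_into (carrier (dan_ring m k P)) (dan_embed m k P) (field_action m g (dan_embed m k P a)))"

end

theory Submission
  imports Defs
begin

text \<open>
  Both \<open>\<delta> \<circ> \<theta>\<close> and \<open>\<theta> \<circ> \<delta>\<close> are derivations along \<open>\<theta>\<close>, hence so is their difference \<open>E\<close>, and \<open>E\<close>
  vanishes on scalars and on \<open>y\<^sub>2, \<dots>, y\<^sub>m\<close>. Applying \<open>E\<close> to \<open>y\<^sub>1 y\<^sub>2^k\<^sub>2 \<cdots> y\<^sub>m^k\<^sub>m = P\<close> gives
  \<open>E(y\<^sub>1) \<theta>(y\<^sub>2^k\<^sub>2 \<cdots> y\<^sub>m^k\<^sub>m) = \<theta>(\<partial>P/\<partial>z) E(z)\<close>, so in the domain \<open>\<bbbK>[\<V>]\<close> the conditions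
  \<open>E(y\<^sub>1) = 0\<close>, \<open>E(z) = 0\<close> and \<open>E = 0\<close> are equivalent; and \<open>E(z)\<close> is \<open>y\<^sub>2^k\<^sub>2 \<cdots> y\<^sub>m^k\<^sub>m\<close> times the difference
  of the two sides of (b).

  All computations take place in the fraction field, where \<open>\<bbbK>[\<V>]\<close> embeds because the kernel of
  \<open>Y\<^sub>1 \<mapsto> P / (y\<^sub>2^k\<^sub>2 \<cdots> y\<^sub>m^k\<^sub>m)\<close> is generated by \<open>Y\<^sub>1 M - P\<close>, where \<open>M = Y\<^sub>2^k\<^sub>2 \<cdots> Y\<^sub>m^k\<^sub>m\<close>: for \<open>f\<close> in the
  kernel, some \<open>M^n f\<close> lies in that ideal, and each factor \<open>Y\<^sub>i\<close> can be cancelled since \<open>P\<close>, being monic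
  in \<open>Z\<close>, does not vanish at \<open>Y\<^sub>i = 0\<close>.
\<close>

section \<open>Evaluation of multivariate polynomials\<close>

abbreviation mono_at :: "(nat \<Rightarrow> 'a::comm_ring_1) \<Rightarrow> (nat \<Rightarrow>\<^sub>0 nat) \<Rightarrow> 'a" where
  "mono_at x e \<equiv> (\<Prod>i \<in> Poly_Mapping.keys e. x i ^ Poly_Mapping.lookup e i)"

text \<open>Additional factors are \<open>x i ^ 0 = 1\<close>. A common index set lets monomials
  with different supports be multiplied factor by factor.\<close>

lemma mono_at_superset:
  assumes "finite S" "Poly_Mapping.keys e \<subseteq> S"
  shows "mono_at x e = (\<Prod>i\<in>S. x i ^ Poly_Mapping.lookup e i)"
  by (rule prod.mono_neutral_left) (use assms in \<open>auto simp: in_keys_iff\<close>)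

lemma mono_at_add: "mono_at x (e + f) = mono_at x e * mono_at x f"
proof -
  let ?S = "Poly_Mapping.keys e \<union> Poly_Mapping.keys f"
  have "mono_at x (e + f) = (\<Prod>i\<in>?S. x i ^ Poly_Mapping.lookup (e + f) i)"
    by (rule mono_at_superset) (simp_all add: Poly_Mapping.keys_add)
  also have "\<dots> = mono_at x e * mono_at x f"
    by (simp add: mono_at_superset[of ?S] lookup_add power_add prod.distrib)
  finally show ?thesis .
qed

text \<open>The target ring is left open to cover three uses: substituting polynomials, substituting
  fractions (\<open>msubst\<close>), and reading a polynomial as univariate in one of its
  variables.\<close>

definition meval :: "('k::comm_ring_1 \<Rightarrow> 'a::comm_ring_1) \<Rightarrow> (nat \<Rightarrow> 'a) \<Rightarrow> 'k mpoly \<Rightarrow> 'a" where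
  "meval c x p = (\<Sum>e \<in> Poly_Mapping.keys p. c (Poly_Mapping.lookup p e) * mono_at x e)"

lemma poly_mapping_expand:
  "p = (\<Sum>e \<in> Poly_Mapping.keys p. Poly_Mapping.single e (Poly_Mapping.lookup p e))"
  by (rule poly_mapping_eqI)
    (auto simp: lookup_sum lookup_single when_def in_keys_iff sum.delta)

locale coeff_hom =
  fixes c :: "'k::comm_ring_1 \<Rightarrow> 'a::comm_ring_1"
  assumes hom_0 [simp]: "c 0 = 0" and hom_1 [simp]: "c 1 = 1"
    and hom_add: "c (a + b) = c a + c b" and hom_mult: "c (a * b) = c a * c b"
begin

lemma meval_superset:
  assumes "finite S" "Poly_Mapping.keys p \<subseteq> S"
  shows "meval c x p = (\<Sum>e\<in>S. c (Poly_Mapping.lookup p e) * mono_at x e)"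
  unfolding meval_def
  by (rule sum.mono_neutral_left) (use assms in \<open>auto simp: in_keys_iff\<close>)

lemma meval_add: "meval c x (p + q) = meval c x p + meval c x q"
proof -
  let ?S = "Poly_Mapping.keys p \<union> Poly_Mapping.keys q"
  have "meval c x (p + q) = (\<Sum>e\<in>?S. c (Poly_Mapping.lookup (p + q) e) * mono_at x e)"
    by (rule meval_superset) (simp_all add: Poly_Mapping.keys_add)
  also have "\<dots> = meval c x p + meval c x q"
    by (simp add: meval_superset[of ?S] lookup_add hom_add distrib_right sum.distrib)
  finally show ?thesis .
qed

lemma meval_0 [simp]: "meval c x 0 = 0"
  by (simp add: meval_def)

lemma meval_sum: "meval c x (sum f S) = (\<Sum>i\<in>S. meval c x (f i))"
  by (induction S rule: infinite_finite_induct) (simp_all add: meval_add)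

lemma meval_single [simp]: "meval c x (Poly_Mapping.single e a) = c a * mono_at x e"
  by (auto simp: meval_def)

lemma meval_mult: "meval c x (p * q) = meval c x p * meval c x q"
proof -
  \<comment> \<open>Different pairs \<open>(e, f)\<close> may have the same sum
    \<open>e + f\<close>. Expanding into single monomials leaves the collection of equal terms to
    additivity.\<close>
  have "p * q = (\<Sum>e \<in> Poly_Mapping.keys p. \<Sum>f \<in> Poly_Mapping.keys q.
      Poly_Mapping.single (e + f) (Poly_Mapping.lookup p e * Poly_Mapping.lookup q f))"
    by (simp add: sum_product flip: mult_single) (simp add: sum_product[symmetric] flip: poly_mapping_expand)
  then have "meval c x (p * q) = (\<Sum>e \<in> Poly_Mapping.keys p. \<Sum>f \<in> Poly_Mapping.keys q.
      c (Poly_Mapping.lookup p e * Poly_Mapping.lookup q f) * mono_at x (e + f))"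
    by (simp only: meval_sum meval_single)
  also have "\<dots> = meval c x p * meval c x q"
    by (simp add: meval_def sum_product hom_mult mono_at_add mult_ac)
  finally show ?thesis .
qed

lemma meval_const [simp]: "meval c x (mconst a) = c a"
  by (simp add: mconst_def)

lemma meval_1 [simp]: "meval c x 1 = 1"
  using meval_const[of x 1] by (simp add: mconst_def)

lemma meval_var [simp]: "meval c x (mvar i) = x i"
  by (simp add: mvar_def)

lemma meval_uminus: "meval c x (- p) = - meval c x p"
  using meval_add[of x p "- p"] by (simp add: eq_neg_iff_add_eq_0 add.commute)

lemma meval_diff: "meval c x (p - q) = meval c x p - meval c x q"
  using meval_add[of x p "- q"] by (simp add: meval_uminus)

lemma meval_power: "meval c x (p ^ n) = meval c x p ^ n"
  by (induction n) (simp_all add: meval_mult)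

lemma meval_prod: "meval c x (prod f S) = (\<Prod>i\<in>S. meval c x (f i))"
  by (induction S rule: infinite_finite_induct) (simp_all add: meval_mult)

lemmas meval_hom = meval_add meval_sum meval_mult meval_uminus meval_diff meval_power meval_prod

end

lemma mconst_0 [simp]: "mconst 0 = 0" and mconst_1 [simp]: "mconst 1 = 1"
  by (simp_all add: mconst_def)

lemma mconst_mult: "mconst (a * b) = mconst a * mconst b"
  by (simp add: mconst_def mult_single)

lemma mconst_add: "mconst (a + b) = mconst a + mconst b"
  by (simp add: mconst_def single_add)

lemma mconst_eq_0_iff [simp]: "mconst a = 0 \<longleftrightarrow> a = 0"
  unfolding mconst_def by (metis lookup_single_eq lookup_zero single_zero)

interpretation pol: coeff_hom "mconst :: 'k::comm_ring_1 \<Rightarrow> 'k mpoly"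
  by unfold_locales (simp_all add: mconst_add mconst_mult)

lemma single_conv_mono_at: "Poly_Mapping.single e a = mconst a * mono_at mvar e"
proof -
  have pow: "mvar i ^ n = (Poly_Mapping.single (Poly_Mapping.single i n) 1 :: 'a mpoly)" for i n
    by (induction n) (simp_all add: mvar_def mult_single flip: single_add)
  have "(\<Prod>i\<in>S. mvar i ^ f i) = (Poly_Mapping.single (\<Sum>i\<in>S. Poly_Mapping.single i (f i)) 1 :: 'a mpoly)"
    for S and f :: "nat \<Rightarrow> nat"
    by (induction S rule: infinite_finite_induct) (simp_all add: pow mult_single)
  then show ?thesis
    by (simp add: mconst_def mult_single flip: poly_mapping_expand)
qed

lemma meval_mvar: "meval mconst mvar p = p"
  by (simp add: meval_def flip: single_conv_mono_at poly_mapping_expand)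

section \<open>Polynomials in a prescribed set of variables\<close>

lemma mpolys_0 [simp]: "0 \<in> mpolys V"
  by (simp add: mpolys_def)

lemma mpolys_add: "p \<in> mpolys V \<Longrightarrow> q \<in> mpolys V \<Longrightarrow> p + q \<in> mpolys V"
  using Poly_Mapping.keys_add[of p q] by (auto simp: mpolys_def)

lemma mpolys_mult: "p \<in> mpolys V \<Longrightarrow> q \<in> mpolys V \<Longrightarrow> p * q \<in> mpolys V"
proof -
  assume pq: "p \<in> mpolys V" "q \<in> mpolys V"
  have "Poly_Mapping.keys e \<subseteq> V" if "e \<in> Poly_Mapping.keys (p * q)" for e
  proof -
    obtain a b where "e = a + b" "a \<in> Poly_Mapping.keys p" "b \<in> Poly_Mapping.keys q"
      using \<open>e \<in> _\<close> Poly_Mapping.keys_mult[of p q] by blast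
    with pq show ?thesis
      using Poly_Mapping.keys_add[of a b] unfolding mpolys_def by blast
  qed
  then show ?thesis
    by (simp add: mpolys_def)
qed

lemma mpolys_const [simp]: "mconst a \<in> mpolys V"
  by (simp add: mpolys_def mconst_def)

lemma mpolys_1 [simp]: "1 \<in> mpolys V"
  using mpolys_const[of 1] by simp

lemma mpolys_var: "i \<in> V \<Longrightarrow> mvar i \<in> mpolys V"
  by (simp add: mpolys_def mvar_def)

lemma mvar_nonzero [simp]: "mvar i \<noteq> 0"
  unfolding mvar_def by (metis lookup_single_eq lookup_zero zero_neq_one)

lemma mpolys_uminus: "p \<in> mpolys V \<Longrightarrow> - p \<in> mpolys V"
  by (simp add: mpolys_def)

lemma mpolys_diff: "p \<in> mpolys V \<Longrightarrow> q \<in> mpolys V \<Longrightarrow> p - q \<in> mpolys V"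
  using mpolys_add[OF _ mpolys_uminus, of p V q] by simp

lemma mpolys_power: "p \<in> mpolys V \<Longrightarrow> p ^ n \<in> mpolys V"
  by (induction n) (simp_all add: mpolys_mult)

lemma mpolys_sum: "(\<And>i. i \<in> S \<Longrightarrow> f i \<in> mpolys V) \<Longrightarrow> sum f S \<in> mpolys V"
  by (induction S rule: infinite_finite_induct) (auto intro: mpolys_add)

lemma mpolys_prod: "(\<And>i. i \<in> S \<Longrightarrow> f i \<in> mpolys V) \<Longrightarrow> prod f S \<in> mpolys V"
  by (induction S rule: infinite_finite_induct) (auto intro: mpolys_mult)

lemma mpolys_mono: "V \<subseteq> W \<Longrightarrow> mpolys V \<subseteq> mpolys W"
  by (fastforce simp: mpolys_def)

text \<open>By \<open>meval_mvar\<close>, every polynomial is a sum of constants times products of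
  powers of variables, so it is built by the four rules.\<close>

lemma mpolys_induct [consumes 1, case_names const var add mult]:
  assumes "p \<in> mpolys V"
    and const: "\<And>a. Q (mconst a)"
    and var: "\<And>i. i \<in> V \<Longrightarrow> Q (mvar i)"
    and add: "\<And>p q. p \<in> mpolys V \<Longrightarrow> q \<in> mpolys V \<Longrightarrow> Q p \<Longrightarrow> Q q \<Longrightarrow> Q (p + q)"
    and mult: "\<And>p q. p \<in> mpolys V \<Longrightarrow> q \<in> mpolys V \<Longrightarrow> Q p \<Longrightarrow> Q q \<Longrightarrow> Q (p * q)"
  shows "Q p"
proof -
  \<comment> \<open>Membership is carried along because the rules \<open>add\<close> and
    \<open>mult\<close> are only available for members of \<open>mpolys V\<close>.\<close>
  define Q' where "Q' p \<longleftrightarrow> p \<in> mpolys V \<and> Q p" for p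
  have Q'const: "Q' (mconst a)" for a
    by (simp add: Q'_def const)
  have Q'mult: "Q' (p * q)" if "Q' p" "Q' q" for p q
    using that by (simp add: Q'_def mult mpolys_mult)
  have Q'add: "Q' (p + q)" if "Q' p" "Q' q" for p q
    using that by (simp add: Q'_def add mpolys_add)
  have Q'0: "Q' 0" and Q'1: "Q' 1"
    using Q'const[of 0] Q'const[of 1] by simp_all
  have Q'var: "Q' (mvar i)" if "i \<in> V" for i
    using that by (simp add: Q'_def var mpolys_var)
  have Q'pow: "Q' (mvar i ^ n)" if "i \<in> V" for i n
    by (induction n) (use that in \<open>auto intro: Q'1 Q'mult Q'var\<close>)
  have Q'prod: "Q' (prod f S)" if "\<And>i. i \<in> S \<Longrightarrow> Q' (f i)" for f and S :: "nat set"
    using that by (induction S rule: infinite_finite_induct) (auto intro: Q'1 Q'mult)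
  have Q'sum: "Q' (sum f S)" if "\<And>i. i \<in> S \<Longrightarrow> Q' (f i)" for f and S :: "(nat \<Rightarrow>\<^sub>0 nat) set"
    using that by (induction S rule: infinite_finite_induct) (auto intro: Q'0 Q'add)
  have "Q' (meval mconst mvar p)"
    unfolding meval_def using assms(1)
    by (intro Q'sum Q'mult Q'const Q'prod Q'pow) (auto simp: mpolys_def)
  then show ?thesis
    by (simp add: Q'_def meval_mvar)
qed

lemma (in coeff_hom) meval_meval:
  "meval c x (meval mconst w p) = meval c (\<lambda>i. meval c x (w i)) p"
  by (simp add: meval_def[of mconst] meval_def[of c "\<lambda>i. meval c x (w i)"] meval_hom)

lemma meval_cong:
  assumes "p \<in> mpolys V" "\<And>i. i \<in> V \<Longrightarrow> x i = y i"
  shows "meval c x p = meval c y p"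
  unfolding meval_def
  by (intro sum.cong prod.cong refl arg_cong2[where f = "(*)"])
    (use assms in \<open>fastforce simp: mpolys_def\<close>)

lemma meval_in_mpolys:
  assumes "p \<in> mpolys V" "\<And>i. i \<in> V \<Longrightarrow> w i \<in> mpolys W"
  shows "meval mconst w p \<in> mpolys W"
  unfolding meval_def
  by (intro mpolys_sum mpolys_mult mpolys_prod mpolys_power mpolys_const assms)
    (use assms in \<open>auto simp: mpolys_def\<close>)

text \<open>Division by a variable, with the value at \<open>Y_i = 0\<close> as remainder. If that
  value vanishes, the variable divides \<open>p\<close>, which is how \<open>I_cancel_var\<close>
  uses it.\<close>

lemma mpolys_factor_var:
  assumes "p \<in> mpolys V" "i \<in> V"
  shows "\<exists>q \<in> mpolys V. p = meval mconst (mvar(i := 0)) p + mvar i * q"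
  using assms(1)
proof (induction rule: mpolys_induct)
  case (const a)
  show ?case by (intro bexI[of _ 0]) auto
next
  case (var j)
  show ?case
    by (cases "j = i") (auto intro: bexI[of _ 0] bexI[of _ 1])
next
  case (add p q)
  let ?w = "meval mconst (mvar(i := 0))"
  obtain u v where uv: "u \<in> mpolys V" "v \<in> mpolys V"
    "p = ?w p + mvar i * u" "q = ?w q + mvar i * v" using add by blast
  have "p + q = (?w p + mvar i * u) + (?w q + mvar i * v)"
    using uv by simp
  also have "\<dots> = ?w (p + q) + mvar i * (u + v)"
    by (simp only: pol.meval_add distrib_left add_ac)
  finally show ?case
    by (rule bexI) (simp add: uv mpolys_add)
next
  case (mult p q)
  let ?w = "meval mconst (mvar(i := 0))"
  obtain u v where uv: "u \<in> mpolys V" "v \<in> mpolys V"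
    "p = ?w p + mvar i * u" "q = ?w q + mvar i * v" using mult by blast
  \<comment> \<open>Only one factor is expanded at a time: first \<open>p\<close>, then
    \<open>q\<close> in the product with the remainder of \<open>p\<close>.\<close>
  have "p * q = ?w (p * q) + mvar i * (u * q + ?w p * v)"
  proof -
    have "p * q = (?w p + mvar i * u) * q"
      by (simp only: uv(3)[symmetric])
    also have "\<dots> = ?w p * q + mvar i * (u * q)"
      by (simp only: distrib_right mult.assoc)
    also have "?w p * q = ?w p * (?w q + mvar i * v)"
      by (simp only: uv(4)[symmetric])
    also have "?w p * (?w q + mvar i * v) + mvar i * (u * q)
        = ?w (p * q) + mvar i * (u * q + ?w p * v)"
      by (simp only: pol.meval_mult distrib_left mult_ac add_ac)
    finally show ?thesis .
  qed
  then show ?case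
  proof (rule bexI)
    show "u * q + ?w p * v \<in> mpolys V"
      by (intro mpolys_add mpolys_mult uv mult meval_in_mpolys[OF mult(1)]) (auto simp: mpolys_var)
  qed
qed

text \<open>Send the variable \<open>v\<close> to a univariate indeterminate and all others to
  constants. As the \<open>s j\<close> do not involve \<open>v\<close>, the image has coefficient
  \<open>mconst a\<close> in degree \<open>n\<close>.\<close>

lemma univariate_nonzero:
  assumes "a \<noteq> 0" "v \<notin> V" "\<And>j. j < n \<Longrightarrow> s j \<in> mpolys V"
  shows "mconst a * mvar v ^ n + (\<Sum>j<n. s j * mvar v ^ j) \<noteq> (0 :: 'k::field mpoly)"
proof
  assume eq: "mconst a * mvar v ^ n + (\<Sum>j<n. s j * mvar v ^ j) = (0 :: 'k mpoly)"
  define x where "x i = (if i = v then monom 1 1 else [:mvar i :: 'k mpoly:])" for i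
  interpret u: coeff_hom "\<lambda>a::'k. [:mconst a:]"
    by unfold_locales (simp_all add: mconst_add mconst_mult)
  let ?E = "meval (\<lambda>a. [:mconst a:]) x"
  have const: "?E p = [:p:]" if "p \<in> mpolys V" for p
    using that assms(2) by (induction rule: mpolys_induct) (auto simp: x_def u.meval_hom)
  have "?E (mconst a * mvar v ^ n + (\<Sum>j<n. s j * mvar v ^ j))
      = smult (mconst a) (monom 1 n) + (\<Sum>j<n. smult (s j) (monom 1 j))"
    by (simp add: u.meval_hom const assms(3) x_def monom_power)
  then have "coeff (smult (mconst a) (monom 1 n) + (\<Sum>j<n. smult (s j) (monom 1 j))) n = 0"
    by (simp add: eq)
  then show False
    using assms(1) by (simp add: coeff_sum)
qed

section \<open>Fractions and substitution of fractions\<close>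

lemma mfrac_add: "mfrac (p + q) = mfrac p + mfrac q"
  and mfrac_mult: "mfrac (p * q) = mfrac p * mfrac q"
  and mfrac_0 [simp]: "mfrac 0 = 0"
  and mfrac_1 [simp]: "mfrac 1 = 1"
  and mfrac_eq_0_iff [simp]: "mfrac p = 0 \<longleftrightarrow> p = 0"
  by (simp_all add: mfrac_def Zero_fract_def One_fract_def eq_fract)

lemma mfrac_eq_iff [simp]: "mfrac p = mfrac q \<longleftrightarrow> p = q"
  by (simp add: mfrac_def eq_fract)

lemma mfrac_sum: "mfrac (sum f S) = (\<Sum>i\<in>S. mfrac (f i))"
  by (induction S rule: infinite_finite_induct) (simp_all add: mfrac_add)

lemma mfrac_power: "mfrac (p ^ n) = mfrac p ^ n"
  by (induction n) (simp_all add: mfrac_mult)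

lemma mfrac_prod: "mfrac (prod f S) = (\<Prod>i\<in>S. mfrac (f i))"
  by (induction S rule: infinite_finite_induct) (simp_all add: mfrac_mult)

lemma mfrac_const_of_nat: "mfrac (mconst (of_nat n)) = of_nat n"
  by (induction n) (simp_all add: mconst_add mfrac_add)

lemma Fract_conv_mfrac: "b \<noteq> 0 \<Longrightarrow> Fraction_Field.Fract a b = mfrac a / mfrac b"
  by (simp add: mfrac_def)

interpretation rat: coeff_hom "\<lambda>a::'k::field. mfrac (mconst a)"
  by unfold_locales (simp_all add: mconst_add mconst_mult mfrac_add mfrac_mult)

lemma msubst_eq_meval: "msubst x p = meval (\<lambda>a. mfrac (mconst a)) x p"
  by (simp add: msubst_def meval_def)

lemma msubst_0 [simp]: "msubst x 0 = 0"
  and msubst_1 [simp]: "msubst x 1 = 1"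
  and msubst_const [simp]: "msubst x (mconst a) = mfrac (mconst a)"
  and msubst_var [simp]: "msubst x (mvar i) = x i"
  by (simp_all add: msubst_eq_meval)

lemma msubst_add: "msubst x (p + q) = msubst x p + msubst x q"
  and msubst_mult: "msubst x (p * q) = msubst x p * msubst x q"
  and msubst_diff: "msubst x (p - q) = msubst x p - msubst x q"
  and msubst_power: "msubst x (p ^ n) = msubst x p ^ n"
  and msubst_prod: "msubst x (prod f S) = (\<Prod>i\<in>S. msubst x (f i))"
  by (simp_all add: msubst_eq_meval rat.meval_hom)

lemma msubst_sum: "msubst x (sum f S) = (\<Sum>j\<in>S. msubst x (f j))"
  by (simp add: msubst_eq_meval rat.meval_hom)

lemma msubst_mfrac: "msubst (\<lambda>i. mfrac (w i)) p = mfrac (meval mconst w p)"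
  by (simp add: msubst_def meval_def mfrac_sum mfrac_mult mfrac_prod mfrac_power)

lemma msubst_cong:
  "p \<in> mpolys V \<Longrightarrow> (\<And>i. i \<in> V \<Longrightarrow> x i = y i) \<Longrightarrow> msubst x p = msubst y p"
  unfolding msubst_eq_meval by (rule meval_cong)

section \<open>The coordinate ring and its embedding\<close>

lemma cring_mpoly_ring: "cring (mpoly_ring V)" (is "cring ?R")
proof (rule cringI)
  show "abelian_group ?R"
  proof (rule abelian_groupI)
    fix p assume "p \<in> carrier ?R"
    then show "\<exists>q\<in>carrier ?R. q \<oplus>\<^bsub>?R\<^esub> p = \<zero>\<^bsub>?R\<^esub>"
      by (intro bexI[of _ "- p"]) (auto simp: mpoly_ring_def mpolys_uminus)
  qed (auto simp: mpoly_ring_def mpolys_add)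
  show "Group.comm_monoid ?R"
    by (rule comm_monoidI) (auto simp: mpoly_ring_def mpolys_mult mult_ac)
qed (simp add: mpoly_ring_def distrib_right)

lemma minus_mpoly_ring:
  assumes "p \<in> mpolys V" "q \<in> mpolys V"
  shows "p \<ominus>\<^bsub>mpoly_ring V\<^esub> q = p - q"
proof -
  interpret cring "mpoly_ring V :: 'a mpoly ring" by (rule cring_mpoly_ring)
  have "\<ominus>\<^bsub>mpoly_ring V\<^esub> q = - q"
    by (rule minus_equality) (use assms in \<open>auto simp: mpoly_ring_def mpolys_uminus\<close>)
  then show ?thesis
    by (simp add: a_minus_def) (simp add: mpoly_ring_def)
qed

declare One_nat_def [simp del]

locale danielewski =
  fixes m d :: nat and k :: "nat \<Rightarrow> nat" and s :: "nat \<Rightarrow> 'k::field mpoly" and P :: "'k mpoly"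
  assumes m_pos: "m \<ge> 1" and d_pos: "d \<ge> 1" and k_pos: "\<And>i. i \<in> {2..m} \<Longrightarrow> k i \<ge> 1"
    and s_mpolys: "\<And>j. j < d \<Longrightarrow> s j \<in> mpolys {2..m}"
    and P_eq: "P = dan_poly d m s"
begin

abbreviation "R \<equiv> mpolys {1..Suc m} :: 'k mpoly set"
abbreviation "R0 \<equiv> mpolys {2..Suc m} :: 'k mpoly set"
abbreviation M :: "'k mpoly" where "M \<equiv> dan_monom m k"
abbreviation "I \<equiv> dan_ideal m k P"
abbreviation "A \<equiv> dan_ring m k P"
abbreviation "cls \<equiv> dan_class m k P"
abbreviation "emb \<equiv> dan_embed m k P"
abbreviation "scalar \<equiv> dan_scalar m k P"

lemma R0_R: "p \<in> R0 \<Longrightarrow> p \<in> R"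
  using mpolys_mono[of "{2..Suc m}" "{1..Suc m}"] by auto

lemma mpolys_y_R: "p \<in> mpolys {2..m} \<Longrightarrow> p \<in> R"
  using mpolys_mono[of "{2..m}" "{1..Suc m}"] by auto

lemma P_R0: "P \<in> R0"
proof -
  have "s j \<in> R0" if "j < d" for j
    using s_mpolys[OF that] mpolys_mono[of "{2..m}" "{2..Suc m}"] by auto
  then show ?thesis
    unfolding P_eq dan_poly_def using m_pos
    by (intro mpolys_add mpolys_sum mpolys_mult mpolys_power mpolys_var) auto
qed

lemma M_R0: "M \<in> R0"
  unfolding dan_monom_def by (auto intro!: mpolys_prod mpolys_power mpolys_var)

lemma M_nonzero [simp]: "M \<noteq> 0"
  by (simp add: dan_monom_def)

lemma gen_R: "mvar 1 * M - P \<in> R"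
  by (intro mpolys_diff mpolys_mult mpolys_var R0_R M_R0 P_R0) auto

section \<open>The ideal of the relation and cancellation modulo it\<close>

lemma ideal_eq: "I = {q * (mvar 1 * M - P) | q. q \<in> R}"
  by (simp add: dan_ideal_def cgenideal_def mpoly_ring_def)

lemma ideal_dan_ideal: "ideal I (mpoly_ring {1..Suc m})"
  unfolding dan_ideal_def
  by (rule cring.cgenideal_ideal[OF cring_mpoly_ring]) (use gen_R in \<open>simp add: mpoly_ring_def\<close>)

lemma I_0 [simp]: "0 \<in> I"
  unfolding ideal_eq by (auto intro: exI[of _ 0])

lemma I_add: "p \<in> I \<Longrightarrow> q \<in> I \<Longrightarrow> p + q \<in> I"
  unfolding ideal_eq by (smt (verit) distrib_right mem_Collect_eq mpolys_add)

lemma I_mult: "p \<in> I \<Longrightarrow> q \<in> R \<Longrightarrow> q * p \<in> I"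
  unfolding ideal_eq by (smt (verit) mem_Collect_eq mpolys_mult mult.assoc)

text \<open>Write \<open>Y_i f = q (Y_1 M - P)\<close> and put \<open>Y_i = 0\<close>: the left side
  and \<open>M\<close> vanish, so the values of \<open>q\<close> and \<open>P\<close> have product
  zero. The value of \<open>P\<close> is nonzero, hence \<open>Y_i\<close> divides \<open>q\<close>
  and cancels.\<close>

lemma I_cancel_var:
  assumes "i \<in> {2..m}" "f \<in> R" "mvar i * f \<in> I"
  shows "f \<in> I"
proof -
  let ?w = "meval mconst (mvar(i := 0)) :: 'k mpoly \<Rightarrow> 'k mpoly"
  obtain q where q: "q \<in> R" "mvar i * f = q * (mvar 1 * M - P)"
    using assms(3) by (auto simp: ideal_eq)
  have "i \<in> {1..Suc m}" using assms(1) by auto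
  then obtain r where r: "r \<in> R" "q = ?w q + mvar i * r"
    using mpolys_factor_var[OF q(1)] by blast
  have "?w M = 0"
    using assms(1) k_pos[of i] by (auto simp: dan_monom_def pol.meval_hom intro!: bexI[of _ i])
  \<comment> \<open>Since \<open>i\<close> differs from \<open>Suc m\<close>, the substitution fixes
    \<open>Z\<close> and \<open>P\<close> stays monic of degree \<open>d\<close>.\<close>
  moreover have "?w P \<noteq> 0"
  proof -
    have "?w P = mconst 1 * mvar (Suc m) ^ d + (\<Sum>j<d. ?w (s j) * mvar (Suc m) ^ j)"
      using assms(1) by (simp add: P_eq dan_poly_def pol.meval_hom)
    also have "\<dots> \<noteq> 0"
      by (rule univariate_nonzero[where V = "{2..m}"])
        (auto intro!: meval_in_mpolys[OF s_mpolys] mpolys_var)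
    finally show ?thesis .
  qed
  moreover have "?w (mvar i * f) = ?w (q * (mvar 1 * M - P))"
    by (simp only: q(2))
  ultimately have "?w q = 0"
    by (simp add: pol.meval_hom)
  with r(2) have "q = mvar i * r" by simp
  with q(2) have "mvar i * (f - r * (mvar 1 * M - P)) = 0"
    by (simp add: algebra_simps)
  then have "f = r * (mvar 1 * M - P)"
    by simp
  then show ?thesis
    using r(1) by (auto simp: ideal_eq)
qed

lemma I_cancel_M:
  assumes "f \<in> R" "M ^ n * f \<in> I"
  shows "f \<in> I"
proof -
  \<comment> \<open>The elements that can be cancelled modulo \<open>I\<close> are closed under
    products, so the variables dividing \<open>M\<close> suffice.\<close>
  define canc where "canc a \<longleftrightarrow> a \<in> R \<and> (\<forall>f \<in> R. a * f \<in> I \<longrightarrow> f \<in> I)" for a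
  have one: "canc 1" by (simp add: canc_def)
  have mult: "canc (a * b)" if "canc a" "canc b" for a b
    using that unfolding canc_def mult.assoc by (metis mpolys_mult)
  have pow: "canc (a ^ n)" if "canc a" for a n
    by (induction n) (simp_all add: one mult that)
  have prod: "canc (prod g S)" if "\<And>i. i \<in> S \<Longrightarrow> canc (g i)" for g and S :: "nat set"
    using that by (induction S rule: infinite_finite_induct) (simp_all add: one mult)
  have "canc (mvar i)" if "i \<in> {2..m}" for i
    using that I_cancel_var[OF that] by (simp add: canc_def mpolys_var)
  then have "canc (M ^ n)"
    unfolding dan_monom_def by (intro pow prod)
  then show ?thesis
    using assms by (auto simp: canc_def)
qed

text \<open>Modulo \<open>I\<close> the product \<open>Y_1 M\<close> equals \<open>P\<close>, so
  enough factors \<open>M\<close> eliminate \<open>Y_1\<close>: after inverting \<open>M\<close>,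
  only \<open>Y_2, ..., Y_m, Z\<close> are needed as variables.\<close>

lemma clear_denominators:
  assumes "f \<in> R"
  shows "\<exists>n. \<exists>u \<in> R0. M ^ n * f - u \<in> I"
  using assms
proof (induction rule: mpolys_induct)
  case (const a)
  show ?case by (intro exI[of _ 0] bexI[of _ "mconst a"]) auto
next
  case (var i)
  show ?case
  proof (cases "i = 1")
    case True
    have "M ^ 1 * mvar i - P \<in> I"
      using True by (auto simp: ideal_eq mult.commute intro!: exI[of _ 1])
    then show ?thesis using P_R0 by blast
  next
    case False
    then show ?thesis
      using var by (intro exI[of _ 0] bexI[of _ "mvar i"]) (auto intro: mpolys_var)
  qed
next
  case (add f g)
  then obtain n u l v where uv: "u \<in> R0" "v \<in> R0" "M ^ n * f - u \<in> I" "M ^ l * g - v \<in> I"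
    by blast
  have "M ^ l * (M ^ n * f - u) + M ^ n * (M ^ l * g - v) \<in> I"
    by (intro I_add I_mult uv mpolys_power R0_R M_R0)
  then have "M ^ (n + l) * (f + g) - (M ^ l * u + M ^ n * v) \<in> I"
    by (simp add: algebra_simps power_add)
  moreover have "M ^ l * u + M ^ n * v \<in> R0"
    by (intro mpolys_add mpolys_mult mpolys_power M_R0 uv)
  ultimately show ?case by blast
next
  case (mult f g)
  then obtain n u l v where uv: "u \<in> R0" "v \<in> R0" "M ^ n * f - u \<in> I" "M ^ l * g - v \<in> I"
    by blast
  \<comment> \<open>The mixed terms \<open>u * M ^ l * g\<close> cancel, leaving
    \<open>M ^ (n + l) * f * g - u * v\<close>.\<close>
  have "(M ^ l * g) * (M ^ n * f - u) + u * (M ^ l * g - v) \<in> I"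
    by (intro I_add I_mult uv mpolys_mult mpolys_power R0_R M_R0 mult)
  then have "M ^ (n + l) * (f * g) - u * v \<in> I"
    by (simp add: algebra_simps power_add)
  moreover have "u * v \<in> R0"
    by (intro mpolys_mult uv)
  ultimately show ?case by blast
qed

text \<open>Multiplication by a power of \<open>M\<close> turns \<open>f\<close> into a polynomial
  without \<open>Y_1\<close>, where \<open>inj\<close> applies; then \<open>M\<close> is cancelled.
  The point \<xi> is arbitrary because both \<iota> and \<rho> are needed.\<close>

lemma msubst_eq_0_iff:
  assumes inj: "\<And>p. p \<in> R0 \<Longrightarrow> msubst \<xi> p = 0 \<Longrightarrow> p = 0"
    and rel: "\<xi> 1 * msubst \<xi> M = msubst \<xi> P" and "f \<in> R"
  shows "msubst \<xi> f = 0 \<longleftrightarrow> f \<in> I"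
proof
  have I0: "msubst \<xi> p = 0" if "p \<in> I" for p
    using that rel by (auto simp: ideal_eq msubst_mult msubst_diff)
  then show "f \<in> I \<Longrightarrow> msubst \<xi> f = 0" .
  assume "msubst \<xi> f = 0"
  obtain n u where u: "u \<in> R0" "M ^ n * f - u \<in> I"
    using clear_denominators[OF \<open>f \<in> R\<close>] by blast
  have "msubst \<xi> u = 0"
    using I0[OF u(2)] \<open>msubst \<xi> f = 0\<close> by (simp add: msubst_diff msubst_mult)
  then have "M ^ n * f \<in> I"
    using inj[OF u(1)] u(2) by simp
  then show "f \<in> I"
    by (rule I_cancel_M[OF \<open>f \<in> R\<close>])
qed

section \<open>The embedding into the fraction field\<close>

definition \<iota> :: "nat \<Rightarrow> 'k mpoly fract" where
  "\<iota> i = (if i = 1 then mfrac P / mfrac M else mfrac (mvar i))"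

lemma msubst_\<iota>: "p \<in> R0 \<Longrightarrow> msubst \<iota> p = mfrac p"
proof -
  assume "p \<in> R0"
  then have "msubst \<iota> p = msubst (\<lambda>i. mfrac (mvar i)) p"
    by (rule msubst_cong) (simp add: \<iota>_def)
  then show ?thesis
    by (simp add: msubst_mfrac meval_mvar)
qed

lemma msubst_\<iota>_eq_0_iff: "f \<in> R \<Longrightarrow> msubst \<iota> f = 0 \<longleftrightarrow> f \<in> I"
  by (rule msubst_eq_0_iff) (simp_all add: msubst_\<iota> P_R0 M_R0, simp add: \<iota>_def)

lemma carrier_A: "carrier A = cls ` R"
  by (auto simp: dan_ring_def dan_class_def FactRing_def A_RCOSETS_def' mpoly_ring_def)

lemma cls_hom: "cls \<in> ring_hom (mpoly_ring {1..Suc m}) A"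
  using ideal.rcos_ring_hom[OF ideal_dan_ideal] by (simp add: dan_class_def[abs_def] dan_ring_def)

lemma cls_add: "f \<in> R \<Longrightarrow> g \<in> R \<Longrightarrow> cls f \<oplus>\<^bsub>A\<^esub> cls g = cls (f + g)"
  and cls_mult: "f \<in> R \<Longrightarrow> g \<in> R \<Longrightarrow> cls f \<otimes>\<^bsub>A\<^esub> cls g = cls (f * g)"
  and cls_1: "\<one>\<^bsub>A\<^esub> = cls 1"
  using ring_hom_memE[OF cls_hom] by (simp_all add: mpoly_ring_def)

lemma cls_0: "\<zero>\<^bsub>A\<^esub> = cls 0"
  by (simp add: dan_ring_def dan_class_def FactRing_def a_r_coset_def' mpoly_ring_def)

lemma cls_eq_iff: "f \<in> R \<Longrightarrow> g \<in> R \<Longrightarrow> cls f = cls g \<longleftrightarrow> f - g \<in> I"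
  using ring.quotient_eq_iff_same_a_r_cos[OF cring.axioms(1)[OF cring_mpoly_ring] ideal_dan_ideal, of f g]
  by (simp add: dan_class_def minus_mpoly_ring) (simp add: mpoly_ring_def)

text \<open>The substitution vanishes on \<open>I\<close>, hence is constant on each coset. This
  makes \<open>the_elem\<close> in \<open>dan_embed\<close> meaningful.\<close>

lemma emb_cls: "f \<in> R \<Longrightarrow> emb (cls f) = msubst \<iota> f"
proof -
  assume "f \<in> R"
  have "msubst \<iota> ` cls f = {msubst \<iota> f}"
  proof -
    have *: "msubst \<iota> (p + f) = msubst \<iota> f" if "p \<in> I" for p
    proof -
      have "p \<in> R"
        using that gen_R by (auto simp: ideal_eq intro: mpolys_mult)
      with that show ?thesis
        by (simp add: msubst_add msubst_\<iota>_eq_0_iff)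
    qed
    have "cls f = (\<lambda>p. p + f) ` I"
      by (auto simp: dan_class_def a_r_coset_def' mpoly_ring_def)
    then have "msubst \<iota> ` cls f = (\<lambda>p. msubst \<iota> f) ` I"
      using * by (simp add: image_image)
    then show ?thesis
      by (simp add: image_constant[OF I_0])
  qed
  then show ?thesis
    by (simp add: dan_embed_def \<iota>_def[abs_def])
qed

lemma inj_on_emb: "inj_on emb (carrier A)"
proof (rule inj_onI)
  fix a b assume "a \<in> carrier A" "b \<in> carrier A" "emb a = emb b"
  then obtain f g where fg: "f \<in> R" "g \<in> R" "a = cls f" "b = cls g"
    by (auto simp: carrier_A)
  with \<open>emb a = emb b\<close> have "msubst \<iota> (f - g) = 0"
    by (simp add: emb_cls msubst_diff)
  with fg show "a = b"
    by (simp add: cls_eq_iff msubst_\<iota>_eq_0_iff mpolys_diff)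
qed

lemma emb_add: "a \<in> carrier A \<Longrightarrow> b \<in> carrier A \<Longrightarrow> emb (a \<oplus>\<^bsub>A\<^esub> b) = emb a + emb b"
  and emb_mult: "a \<in> carrier A \<Longrightarrow> b \<in> carrier A \<Longrightarrow> emb (a \<otimes>\<^bsub>A\<^esub> b) = emb a * emb b"
  by (auto simp: carrier_A cls_add cls_mult emb_cls mpolys_add mpolys_mult msubst_add msubst_mult)

lemma cls_carrier [simp]: "f \<in> R \<Longrightarrow> cls f \<in> carrier A"
  by (simp add: carrier_A)

lemma A_add_closed: "a \<in> carrier A \<Longrightarrow> b \<in> carrier A \<Longrightarrow> a \<oplus>\<^bsub>A\<^esub> b \<in> carrier A"
  and A_mult_closed: "a \<in> carrier A \<Longrightarrow> b \<in> carrier A \<Longrightarrow> a \<otimes>\<^bsub>A\<^esub> b \<in> carrier A"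
  by (auto simp: carrier_A cls_add cls_mult mpolys_add mpolys_mult)

text \<open>The image of \<open>h\<close> in the fraction field is nonzero and cancels there. This
  passes from (b) to (b)' once \<theta> fixes \<open>h\<close>.\<close>

lemma scalar_cancel:
  assumes "h \<in> carrier A" "h \<noteq> \<zero>\<^bsub>A\<^esub>"
  shows "scalar a \<otimes>\<^bsub>A\<^esub> h = h \<otimes>\<^bsub>A\<^esub> scalar b \<longleftrightarrow> a = b"
proof
  have "emb h \<noteq> emb (cls 0)"
    using assms inj_onD[OF inj_on_emb, of h "cls 0"] by (auto simp: cls_0)
  then have h: "emb h \<noteq> 0"
    by (simp add: emb_cls)
  assume "scalar a \<otimes>\<^bsub>A\<^esub> h = h \<otimes>\<^bsub>A\<^esub> scalar b"
  then have "emb (scalar a \<otimes>\<^bsub>A\<^esub> h) = emb (h \<otimes>\<^bsub>A\<^esub> scalar b)"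
    by simp
  with h assms(1) have "mfrac (mconst a) = mfrac (mconst b)"
    by (simp add: emb_mult dan_scalar_def emb_cls)
  then have "mconst a = (mconst b :: 'k mpoly)"
    by simp
  then have "mconst (a - b) = (0 :: 'k mpoly)"
    using mconst_add[of "a - b" b] by simp
  then show "a = b"
    by simp
next
  assume "a = b"
  then show "scalar a \<otimes>\<^bsub>A\<^esub> h = h \<otimes>\<^bsub>A\<^esub> scalar b"
    using assms(1) by (auto simp: carrier_A dan_scalar_def cls_mult mult.commute)
qed

end

section \<open>The automorphism of a canonical group element\<close>

locale danielewski_symmetry = danielewski m d k s P
  for m d :: nat and k :: "nat \<Rightarrow> nat" and s :: "nat \<Rightarrow> 'k::field mpoly" and P :: "'k mpoly" +
  fixes \<sigma> :: "nat \<Rightarrow> nat" and t :: "nat \<Rightarrow> 'k"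
  assumes sym: "(\<sigma>, t) \<in> canonical_group m k P"
begin

text \<open>The images of \<open>y_2, ..., y_m, z\<close> under the action. As \<sigma> fixes
  \<open>Suc m\<close>, one formula also covers \<open>z\<close>.\<close>

definition \<chi> :: "nat \<Rightarrow> 'k mpoly fract" where
  "\<chi> i = mfrac (mconst (t i) * mvar (\<sigma> i))"

text \<open>Substituting \<open>\<rho>\<close> is the embedding followed by the action of \<open>(\<sigma>, t)\<close>.\<close>

definition \<rho> :: "nat \<Rightarrow> 'k mpoly fract" where
  "\<rho> i = (if i = 1 then msubst \<chi> P / msubst \<chi> M else \<chi> i)"

abbreviation \<theta> :: "'k mpoly set \<Rightarrow> 'k mpoly set" where
  "\<theta> \<equiv> canonical_aut m k P (\<sigma>, t)"

lemma permutes: "\<sigma> permutes {2..m}"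
  and monom_invariant: "(\<Prod>i = 2..m. mvar (\<sigma> i) ^ k i) = M"
  and t_nonzero: "i \<in> {2..Suc m} \<Longrightarrow> t i \<noteq> 0"
  using sym by (auto simp: canonical_group_def semidirect_group_def monom_perms_def PiE_iff)

lemma \<sigma>_Suc [simp]: "\<sigma> (Suc m) = Suc m"
  by (rule permutes_not_in[OF permutes]) simp

text \<open>The action on polynomials is undone by the inverse substitution. The scalars are known
  to be invertible on \<open>{2..Suc m}\<close>, the variables of \<open>R0\<close>.\<close>

lemma msubst_\<chi>_nonzero:
  assumes "p \<in> R0" "msubst \<chi> p = 0"
  shows "p = 0"
proof -
  define w :: "nat \<Rightarrow> 'k mpoly" where "w i = mconst (t i) * mvar (\<sigma> i)" for i
  \<comment> \<open>Indexed so that \<open>w' (\<sigma> i)\<close> is \<open>mvar i\<close> divided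
    by \<open>t i\<close>.\<close>
  define w' :: "nat \<Rightarrow> 'k mpoly" where "w' i = mconst (inverse (t (inv_into UNIV \<sigma> i))) * mvar (inv_into UNIV \<sigma> i)" for i
  have "meval mconst w p = 0"
    using assms(2) by (simp add: \<chi>_def[abs_def] msubst_mfrac w_def[abs_def])
  then have "0 = meval mconst w' (meval mconst w p)"
    by simp
  also have "\<dots> = meval mconst (\<lambda>i. meval mconst w' (w i)) p"
    by (rule pol.meval_meval)
  also have "\<dots> = meval mconst mvar p"
  proof (rule meval_cong[OF assms(1)])
    fix i assume i: "i \<in> {2..Suc m}"
    have "mconst (t i) * mconst (inverse (t i)) = 1"
      using t_nonzero[OF i] by (simp flip: mconst_mult)
    then show "meval mconst w' (w i) = mvar i"
      by (simp add: w_def w'_def pol.meval_hom permutes_inverses[OF permutes] flip: mult.assoc)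
  qed
  also have "\<dots> = p"
    by (rule meval_mvar)
  finally show ?thesis by simp
qed

lemma msubst_\<rho>: "p \<in> R0 \<Longrightarrow> msubst \<rho> p = msubst \<chi> p"
  by (rule msubst_cong) (auto simp: \<rho>_def)

text \<open>The permutation preserves \<open>M\<close>, so only the scalars act on it; their
  contribution is the factor appearing in (b).\<close>

lemma msubst_\<chi>_M: "msubst \<chi> M = mfrac (mconst (\<Prod>i = 2..m. t i ^ k i) * M)"
proof -
  have prod: "mconst (prod f S) = (\<Prod>i\<in>S. mconst (f i) :: 'k mpoly)" for f and S :: "nat set"
    by (induction S rule: infinite_finite_induct) (simp_all add: mconst_mult)
  have pow: "mconst (a ^ n) = (mconst a ^ n :: 'k mpoly)" for a n
    by (induction n) (simp_all add: mconst_mult)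
  have "msubst \<chi> M = mfrac (\<Prod>i = 2..m. (mconst (t i) * mvar (\<sigma> i)) ^ k i)"
    by (simp add: \<chi>_def dan_monom_def msubst_prod msubst_power mfrac_prod mfrac_power)
  then show ?thesis
    by (simp add: power_mult_distrib prod.distrib monom_invariant prod pow)
qed

lemma msubst_\<chi>_M_nonzero [simp]: "msubst \<chi> M \<noteq> 0"
  using msubst_\<chi>_nonzero[OF M_R0] by auto

lemma msubst_\<rho>_eq_0_iff: "f \<in> R \<Longrightarrow> msubst \<rho> f = 0 \<longleftrightarrow> f \<in> I"
  by (rule msubst_eq_0_iff)
    (auto simp: msubst_\<rho> P_R0 M_R0 intro: msubst_\<chi>_nonzero, simp add: \<rho>_def)

text \<open>Substitution respects the cross-multiplied equation between two representations and
  keeps denominators nonzero, so the value described by \<open>THE\<close> is unique.\<close>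

lemma field_action_Fract:
  assumes "a \<in> R0" "b \<in> R0" "b \<noteq> 0"
  shows "field_action m (\<sigma>, t) (Fraction_Field.Fract a b) = msubst \<chi> a / msubst \<chi> b"
proof -
  have \<chi>: "(\<lambda>i. mfrac (mconst (t i) * mvar (if i = Suc m then Suc m else \<sigma> i))) = \<chi>"
    by (auto simp: \<chi>_def)
  show ?thesis
    unfolding field_action_def prod.case Let_def \<chi>
  proof (rule the_equality)
    fix r
    assume "\<exists>a'\<in>R0. \<exists>b'\<in>R0 - {0}. Fraction_Field.Fract a b = Fraction_Field.Fract a' b' \<and>
      r = msubst \<chi> a' / msubst \<chi> b'"
    then obtain a' b' where ab': "a' \<in> R0" "b' \<in> R0" "b' \<noteq> 0"
      "Fraction_Field.Fract a b = Fraction_Field.Fract a' b'" "r = msubst \<chi> a' / msubst \<chi> b'"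
      by auto
    then have "a * b' = a' * b"
      using assms by (simp add: eq_fract)
    then have "msubst \<chi> (a * b') = msubst \<chi> (a' * b)"
      by simp
    moreover have "msubst \<chi> b \<noteq> 0" "msubst \<chi> b' \<noteq> 0"
      using msubst_\<chi>_nonzero assms ab' by auto
    ultimately show "r = msubst \<chi> a / msubst \<chi> b"
      unfolding ab'(5) msubst_mult by (simp add: field_simps)
  qed (use assms in blast)
qed

text \<open>The action is known on fractions of polynomials without \<open>Y_1\<close>. Clearing
  denominators writes the embedded class of \<open>f\<close> as \<open>u / M ^ n\<close>, and \<rho>
  satisfies the same relation since it too vanishes on \<open>I\<close>.\<close>

lemma field_action_msubst:
  assumes "f \<in> R"
  shows "field_action m (\<sigma>, t) (msubst \<iota> f) = msubst \<rho> f"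
proof -
  obtain n u where u: "u \<in> R0" "M ^ n * f - u \<in> I"
    using clear_denominators[OF assms] by blast
  have R: "M ^ n * f - u \<in> R"
    by (intro mpolys_diff mpolys_mult mpolys_power R0_R M_R0 u assms)
  have "mfrac M ^ n * msubst \<iota> f = mfrac u"
    using msubst_\<iota>_eq_0_iff[OF R] u
    by (simp add: msubst_diff msubst_mult msubst_power msubst_\<iota> M_R0)
  then have "msubst \<iota> f = Fraction_Field.Fract u (M ^ n)"
    by (simp add: Fract_conv_mfrac mfrac_power field_simps)
  then have "field_action m (\<sigma>, t) (msubst \<iota> f) = msubst \<chi> u / msubst \<chi> M ^ n"
    using u by (simp add: field_action_Fract mpolys_power M_R0 msubst_power)
  also have "msubst \<chi> u = msubst \<chi> M ^ n * msubst \<rho> f"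
    using msubst_\<rho>_eq_0_iff[OF R] u
    by (simp add: msubst_diff msubst_mult msubst_power msubst_\<rho> M_R0)
  finally show ?thesis
    by simp
qed

text \<open>The canonical group maps the image of the coordinate ring into itself, so
  \<open>inv_into\<close> is applied to an element of that image.\<close>

lemma \<theta>_cls:
  assumes "f \<in> R"
  shows "\<theta> (cls f) \<in> carrier A" and "emb (\<theta> (cls f)) = msubst \<rho> f"
proof -
  have "field_action m (\<sigma>, t) (emb (cls f)) \<in> emb ` carrier A"
    using sym assms by (auto simp: canonical_group_def)
  then have *: "msubst \<rho> f \<in> emb ` carrier A"
    using assms by (simp add: emb_cls field_action_msubst)
  have eq: "\<theta> (cls f) = inv_into (carrier A) emb (msubst \<rho> f)"
    using assms by (simp add: canonical_aut_def emb_cls field_action_msubst)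
  show "\<theta> (cls f) \<in> carrier A" "emb (\<theta> (cls f)) = msubst \<rho> f"
    using * unfolding eq by (auto intro: inv_into_into f_inv_into_f)
qed

lemma \<theta>_carrier: "a \<in> carrier A \<Longrightarrow> \<theta> a \<in> carrier A"
  using \<theta>_cls by (auto simp: carrier_A)

lemma \<theta>_eqI:
  assumes "f \<in> R" "g \<in> R" "msubst \<rho> f = msubst \<iota> g"
  shows "\<theta> (cls f) = cls g"
  by (rule inj_onD[OF inj_on_emb]) (use assms in \<open>auto simp: \<theta>_cls emb_cls\<close>)

lemma \<theta>_add: "a \<in> carrier A \<Longrightarrow> b \<in> carrier A \<Longrightarrow> \<theta> (a \<oplus>\<^bsub>A\<^esub> b) = \<theta> a \<oplus>\<^bsub>A\<^esub> \<theta> b"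
  and \<theta>_mult: "a \<in> carrier A \<Longrightarrow> b \<in> carrier A \<Longrightarrow> \<theta> (a \<otimes>\<^bsub>A\<^esub> b) = \<theta> a \<otimes>\<^bsub>A\<^esub> \<theta> b"
proof -
  assume "a \<in> carrier A" "b \<in> carrier A"
  then obtain f g where fg: "f \<in> R" "g \<in> R" "a = cls f" "b = cls g"
    by (auto simp: carrier_A)
  show "\<theta> (a \<oplus>\<^bsub>A\<^esub> b) = \<theta> a \<oplus>\<^bsub>A\<^esub> \<theta> b"
    by (rule inj_onD[OF inj_on_emb])
      (simp_all add: fg cls_add \<theta>_cls emb_add A_add_closed mpolys_add msubst_add)
  show "\<theta> (a \<otimes>\<^bsub>A\<^esub> b) = \<theta> a \<otimes>\<^bsub>A\<^esub> \<theta> b"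
    by (rule inj_onD[OF inj_on_emb])
      (simp_all add: fg cls_mult \<theta>_cls emb_mult A_mult_closed mpolys_mult msubst_mult)
qed

lemma \<theta>_const: "\<theta> (cls (mconst c)) = cls (mconst c)"
  by (rule \<theta>_eqI) simp_all

lemma \<sigma>_range: "i \<in> {2..m} \<Longrightarrow> \<sigma> i \<in> {2..m}"
  by (simp only: permutes_in_image[OF permutes])

text \<open>The value is kept as a product of classes so that the Leibniz rule can be applied to
  it.\<close>

lemma \<theta>_var:
  assumes "i \<in> {2..Suc m}"
  shows "\<theta> (cls (mvar i)) = cls (mconst (t i)) \<otimes>\<^bsub>A\<^esub> cls (mvar (\<sigma> i))"
proof -
  have "\<sigma> i \<in> {2..Suc m}"
    using assms \<sigma>_range[of i] by (cases "i = Suc m") auto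
  then have R0: "mvar (\<sigma> i) \<in> R0"
    by (rule mpolys_var)
  then have R0': "mconst (t i) * mvar (\<sigma> i) \<in> R0"
    by (simp add: mpolys_mult)
  have "mvar i \<in> R"
    using assms by (auto intro!: mpolys_var)
  moreover have "msubst \<rho> (mvar i) = msubst \<iota> (mconst (t i) * mvar (\<sigma> i))"
    using assms by (simp only: msubst_\<iota>[OF R0']) (simp add: \<rho>_def \<chi>_def)
  ultimately have "\<theta> (cls (mvar i)) = cls (mconst (t i) * mvar (\<sigma> i))"
    by (intro \<theta>_eqI R0_R[OF R0'])
  then show ?thesis
    by (simp add: cls_mult R0_R R0)
qed

lemma bij_betw_\<theta>: "bij_betw \<theta> (carrier A) (carrier A)"
proof (rule bij_betwI')
  fix a b assume "a \<in> carrier A" "b \<in> carrier A"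
  then obtain f g where fg: "f \<in> R" "g \<in> R" "a = cls f" "b = cls g"
    by (auto simp: carrier_A)
  show "\<theta> a = \<theta> b \<longleftrightarrow> a = b"
  proof
    assume "\<theta> a = \<theta> b"
    then have "msubst \<rho> (f - g) = 0"
      using fg \<theta>_cls(2)[of f] \<theta>_cls(2)[of g] by (simp add: msubst_diff)
    then show "a = b"
      using fg by (simp add: msubst_\<rho>_eq_0_iff cls_eq_iff mpolys_diff)
  qed simp
next
  fix b assume b: "b \<in> carrier A"
  \<comment> \<open>Surjectivity rests on the stabilizer condition being an equality: the image is
    also contained in its transform.\<close>
  have "emb b \<in> field_action m (\<sigma>, t) ` emb ` carrier A"
    using sym b by (auto simp: canonical_group_def)
  then obtain f where f: "f \<in> R" "emb b = msubst \<rho> f"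
    by (auto simp: carrier_A emb_cls field_action_msubst)
  have "b = \<theta> (cls f)"
    by (rule inj_onD[OF inj_on_emb]) (use b f in \<open>simp_all add: \<theta>_cls\<close>)
  then show "\<exists>a\<in>carrier A. b = \<theta> a"
    using f(1) by auto
qed (rule \<theta>_carrier)

lemma \<theta>_alg_auts: "\<theta> \<in> alg_auts A scalar"
proof -
  have "\<theta> \<in> ring_iso A A"
    by (rule ring_iso_memI)
      (use \<theta>_const[of 1] in \<open>simp_all add: \<theta>_carrier \<theta>_add \<theta>_mult bij_betw_\<theta> cls_1\<close>)
  moreover have "\<theta> \<in> extensional (carrier A)"
    by (simp add: canonical_aut_def)
  ultimately show ?thesis
    by (simp add: alg_auts_def dan_scalar_def \<theta>_const)
qed

end

section \<open>The commutation defect\<close>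

locale danielewski_derivation = danielewski_symmetry m d k s P \<sigma> t
  for m d :: nat and k :: "nat \<Rightarrow> nat" and s :: "nat \<Rightarrow> 'k::field_char_0 mpoly" and P :: "'k mpoly"
    and \<sigma> :: "nat \<Rightarrow> nat" and t :: "nat \<Rightarrow> 'k" +
  fixes D :: "'k mpoly set \<Rightarrow> 'k mpoly set" and h :: "'k mpoly set"
  assumes D: "is_canonical_derivation m k P D" and h [simp]: "h \<in> carrier A"
begin

section \<open>Rules for the canonical derivation\<close>

lemma D_carrier: "a \<in> carrier A \<Longrightarrow> D a \<in> carrier A"
  and D_add: "a \<in> carrier A \<Longrightarrow> b \<in> carrier A \<Longrightarrow> D (a \<oplus>\<^bsub>A\<^esub> b) = D a \<oplus>\<^bsub>A\<^esub> D b"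
  and D_mult: "a \<in> carrier A \<Longrightarrow> b \<in> carrier A \<Longrightarrow>
    D (a \<otimes>\<^bsub>A\<^esub> b) = (D a \<otimes>\<^bsub>A\<^esub> b) \<oplus>\<^bsub>A\<^esub> (a \<otimes>\<^bsub>A\<^esub> D b)"
  and D_scalar: "a \<in> carrier A \<Longrightarrow> D (cls (mconst c) \<otimes>\<^bsub>A\<^esub> a) = cls (mconst c) \<otimes>\<^bsub>A\<^esub> D a"
  and D_z: "D (cls (mvar (Suc m))) = cls M"
  and D_y: "i \<in> {2..m} \<Longrightarrow> D (cls (mvar i)) = cls 0"
  using D by (auto simp: is_canonical_derivation_def is_derivation_def dan_scalar_def)

lemmas A_closed = A_add_closed A_mult_closed D_carrier \<theta>_carrier
lemmas A_hom = emb_add emb_mult \<theta>_add \<theta>_mult D_add D_mult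

abbreviation "\<delta> \<equiv> \<lambda>a. h \<otimes>\<^bsub>A\<^esub> D a"

text \<open>The difference \<open>E\<close> of the two compositions, lifted to polynomial
  representatives and with values in the fraction field. Polynomial induction and field arithmetic
  then both apply.\<close>

definition defect :: "'k mpoly \<Rightarrow> 'k mpoly fract" where
  "defect f = emb (\<delta> (\<theta> (cls f))) - emb (\<theta> (\<delta> (cls f)))"

lemma defect_eq_0_iff: "f \<in> R \<Longrightarrow> defect f = 0 \<longleftrightarrow> \<delta> (\<theta> (cls f)) = \<theta> (\<delta> (cls f))"
  by (auto simp: defect_def A_closed dest: inj_onD[OF inj_on_emb])

lemma defect_add: "f \<in> R \<Longrightarrow> g \<in> R \<Longrightarrow> defect (f + g) = defect f + defect g"
  by (simp add: defect_def A_closed A_hom algebra_simps flip: cls_add)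

lemma defect_mult:
  "f \<in> R \<Longrightarrow> g \<in> R \<Longrightarrow> defect (f * g) = defect f * msubst \<rho> g + msubst \<rho> f * defect g"
  by (simp add: defect_def A_closed A_hom \<theta>_cls algebra_simps flip: cls_mult)

text \<open>The Leibniz rule for \<open>1 * 1\<close> gives \<open>D(1) = D(1) + D(1)\<close>, so
  \<open>D(1) = 0\<close>; linearity over scalars does the rest.\<close>

lemma D_const: "D (cls (mconst c)) = cls 0"
proof -
  have "emb (D (cls 1)) = emb (D (cls 1)) + emb (D (cls 1))"
    using arg_cong[OF D_mult[of "cls 1" "cls 1"], of emb]
    by (simp add: cls_mult A_closed A_hom emb_cls)
  then have "emb (D (cls 1)) = 0"
    by (simp only: add_cancel_right_right)
  then have "emb (D (cls 1)) = emb (cls 0)"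
    by (simp add: emb_cls)
  then have "D (cls 1) = cls 0"
    by (rule inj_onD[OF inj_on_emb]) (simp_all add: A_closed)
  then show ?thesis
    using D_scalar[of "cls 1" c] by (simp add: cls_mult)
qed

lemma defect_const [simp]: "defect (mconst c) = 0"
  by (simp add: defect_def \<theta>_const D_const A_hom A_closed emb_cls \<theta>_cls)

lemma defect_y [simp]: "i \<in> {2..m} \<Longrightarrow> defect (mvar i) = 0"
proof -
  assume i: "i \<in> {2..m}"
  then have "mvar i \<in> R" "mvar (\<sigma> i) \<in> R"
    using \<sigma>_range[OF i] by (auto intro!: mpolys_var)
  then show ?thesis
    using i \<sigma>_range[OF i] by (simp add: defect_def \<theta>_var D_const D_y A_hom emb_cls \<theta>_cls A_closed)
qed

text \<open>Since \<open>D(z) = M\<close>, one composition gives \<open>t_{m+1} h M\<close> and the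
  other \<theta>(h) \<theta>(M), where \<theta>(M) is the scalar from \<open>msubst_\<chi>_M\<close>
  times \<open>M\<close>.\<close>

lemma defect_z: "defect (mvar (Suc m)) =
    mfrac M * (emb (scalar (t (Suc m)) \<otimes>\<^bsub>A\<^esub> h)
      - emb (\<theta> h \<otimes>\<^bsub>A\<^esub> scalar (\<Prod>j = 2..m. t j ^ k j)))"
proof -
  have z: "mvar (Suc m) \<in> R"
    by (auto intro!: mpolys_var)
  have "\<theta> (cls (mvar (Suc m))) = cls (mconst (t (Suc m))) \<otimes>\<^bsub>A\<^esub> cls (mvar (Suc m))"
    using \<theta>_var[of "Suc m"] m_pos by simp
  then show ?thesis
    by (simp add: defect_def z D_const D_z A_hom A_closed emb_cls \<theta>_cls R0_R M_R0 dan_scalar_def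
        msubst_\<iota> msubst_\<rho> msubst_\<chi>_M mfrac_mult algebra_simps)
qed

lemma defect_mpolys_y:
  assumes "f \<in> mpolys {2..m}"
  shows "defect f = 0"
  using assms by (induction rule: mpolys_induct) (simp_all add: mpolys_y_R defect_add defect_mult)

lemma defect_vanishes:
  assumes "defect (mvar 1) = 0" "defect (mvar (Suc m)) = 0" "f \<in> R"
  shows "defect f = 0"
  using assms(3)
proof (induction rule: mpolys_induct)
  case (var i)
  then consider "i = 1" | "i \<in> {2..m}" | "i = Suc m" by force
  then show ?case using assms by cases auto
qed (simp_all add: defect_add defect_mult)

text \<open>For \<open>n = 0\<close> the truncated exponent is harmless because of the factor
  \<open>of_nat n\<close>.\<close>

lemma defect_power_z: "defect (mvar (Suc m) ^ n) =
    of_nat n * msubst \<rho> (mvar (Suc m)) ^ (n - 1) * defect (mvar (Suc m))"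
proof (induction n)
  case 0
  show ?case using defect_const[of 1] by simp
next
  case (Suc n)
  have "mvar (Suc m) \<in> R"
    by (auto intro!: mpolys_var)
  with Suc show ?case
    by (cases n) (simp_all add: defect_mult mpolys_power mpolys_mult msubst_mult msubst_power algebra_simps)
qed

text \<open>\<open>\<partial>P/\<partial>z\<close>, written by its coefficients to show that it is nonzero.\<close>

definition dP :: "'k mpoly" where
  "dP = mconst (of_nat d) * mvar (Suc m) ^ (d - 1)
     + (\<Sum>j<d - 1. (mconst (of_nat (Suc j)) * s (Suc j)) * mvar (Suc m) ^ j)"

lemma defect_0: "defect 0 = 0"
  using defect_const[of 0] by simp

lemma defect_sum: "finite S \<Longrightarrow> (\<And>j. j \<in> S \<Longrightarrow> f j \<in> R) \<Longrightarrow> defect (sum f S) = (\<Sum>j\<in>S. defect (f j))"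
  by (induction S rule: finite_induct) (simp_all add: defect_add mpolys_sum defect_0)

text \<open>The coefficients \<open>s j\<close> have defect zero, so only powers of \<open>Z\<close>
  contribute, as in differentiation with respect to \<open>Z\<close>.\<close>

lemma defect_P: "defect P = msubst \<rho> dP * defect (mvar (Suc m))"
proof -
  let ?z = "mvar (Suc m) :: 'k mpoly"
  let ?r = "msubst \<rho> :: 'k mpoly \<Rightarrow> _"
  have z: "?z \<in> R"
    by (auto intro!: mpolys_var)
  have s: "s j \<in> R" "defect (s j) = 0" if "j < d" for j
    using s_mpolys[OF that] by (auto intro: mpolys_y_R defect_mpolys_y)
  have terms: "s j * ?z ^ j \<in> R" if "j < d" for j
    by (intro mpolys_mult mpolys_power z s(1) that)
  have "defect P = defect (?z ^ d + (\<Sum>j<d. s j * ?z ^ j))"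
    by (rule arg_cong[where f = defect]) (simp add: P_eq dan_poly_def)
  also have "\<dots> = defect (?z ^ d) + (\<Sum>j<d. defect (s j * ?z ^ j))"
  proof -
    have "(\<Sum>j<d. s j * ?z ^ j) \<in> R"
      by (rule mpolys_sum) (simp add: terms)
    moreover have "defect (\<Sum>j<d. s j * ?z ^ j) = (\<Sum>j<d. defect (s j * ?z ^ j))"
      by (rule defect_sum) (simp_all add: terms)
    ultimately show ?thesis
      by (simp add: defect_add mpolys_power z)
  qed
  also have "(\<Sum>j<d. defect (s j * ?z ^ j)) = (\<Sum>j<d. of_nat j * ?r (s j) * ?r ?z ^ (j - 1) * defect ?z)"
    by (intro sum.cong refl) (use z s in \<open>simp add: defect_mult mpolys_power defect_power_z\<close>)
  \<comment> \<open>As \<open>d\<close> is positive, the term \<open>j = 0\<close> can be split off;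
    it vanishes, and the shifted sum has the coefficients of \<open>dP\<close>.\<close>
  also have "\<dots> = (\<Sum>j<Suc (d - 1). of_nat j * ?r (s j) * ?r ?z ^ (j - 1) * defect ?z)"
    using d_pos by simp
  also have "\<dots> = (\<Sum>j<d - 1. of_nat (Suc j) * ?r (s (Suc j)) * ?r ?z ^ j * defect ?z)"
    by (subst sum.lessThan_Suc_shift) simp
  finally show ?thesis
    by (simp add: defect_power_z dP_def msubst_add msubst_mult msubst_power msubst_sum mfrac_const_of_nat
        distrib_right sum_distrib_right del: of_nat_Suc)
qed

lemma dP_R0: "dP \<in> R0"
proof -
  have "s j \<in> R0" if "j < d" for j
    using s_mpolys[OF that] mpolys_mono[of "{2..m}" "{2..Suc m}"] by auto
  then show ?thesis
    unfolding dP_def using m_pos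
    by (intro mpolys_add mpolys_sum mpolys_mult mpolys_power mpolys_var mpolys_const) auto
qed

text \<open>Characteristic zero enters here: the leading coefficient \<open>d\<close> of
  \<open>dP\<close> in \<open>Z\<close> is nonzero, and the action is injective on
  \<open>R0\<close>.\<close>

lemma msubst_\<rho>_dP_nonzero: "msubst \<rho> dP \<noteq> 0"
proof -
  have "dP \<noteq> 0"
    unfolding dP_def
  proof (rule univariate_nonzero)
    show "of_nat d \<noteq> (0 :: 'k)" "Suc m \<notin> {2..m}"
      using d_pos by auto
    show "mconst (of_nat (Suc j)) * s (Suc j) \<in> mpolys {2..m}" if "j < d - 1" for j
      using that by (intro mpolys_mult mpolys_const s_mpolys) simp
  qed
  then show ?thesis
    using msubst_\<chi>_nonzero[OF dP_R0] by (auto simp: msubst_\<rho> dP_R0)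
qed

lemma defect_y1_iff: "defect (mvar 1) = 0 \<longleftrightarrow> defect (mvar (Suc m)) = 0"
proof -
  have R: "mvar 1 \<in> R" "M \<in> R" "P \<in> R"
    by (auto intro: mpolys_var R0_R M_R0 P_R0)
  have "mvar 1 * M - P \<in> I"
    by (auto simp: ideal_eq intro!: exI[of _ 1])
  then have "cls (mvar 1 * M) = cls P"
    using R by (simp add: cls_eq_iff mpolys_mult)
  \<comment> \<open>The defect of a polynomial depends only on its class.\<close>
  then have "defect (mvar 1 * M) = defect P"
    by (simp add: defect_def)
  moreover have "defect M = 0"
    unfolding dan_monom_def by (intro defect_mpolys_y mpolys_prod mpolys_power mpolys_var)
  ultimately have "defect (mvar 1) * msubst \<chi> M = msubst \<rho> dP * defect (mvar (Suc m))"
    using R by (simp add: defect_mult defect_P msubst_\<rho> M_R0)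
  then show ?thesis
    using msubst_\<rho>_dP_nonzero msubst_\<chi>_M_nonzero by (metis mult_eq_0_iff)
qed

lemma commutes_iff:
  "(\<forall>a \<in> carrier A. \<theta> (\<delta> a) = \<delta> (\<theta> a)) \<longleftrightarrow> defect (mvar (Suc m)) = 0"
proof
  assume "\<forall>a \<in> carrier A. \<theta> (\<delta> a) = \<delta> (\<theta> a)"
  then show "defect (mvar (Suc m)) = 0"
    by (simp add: defect_def mpolys_var)
next
  assume z: "defect (mvar (Suc m)) = 0"
  show "\<forall>a \<in> carrier A. \<theta> (\<delta> a) = \<delta> (\<theta> a)"
  proof
    fix a assume "a \<in> carrier A"
    then obtain f where f: "f \<in> R" "a = cls f"
      by (auto simp: carrier_A)
    then show "\<theta> (\<delta> a) = \<delta> (\<theta> a)"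
      using defect_vanishes[OF _ z f(1)] defect_y1_iff z defect_eq_0_iff by simp
  qed
qed

text \<open>The factor \<open>M\<close> in \<open>defect_z\<close> cancels in the field, and
  \<open>emb\<close> is injective.\<close>

lemma defect_z_eq_0_iff:
  "defect (mvar (Suc m)) = 0 \<longleftrightarrow>
    scalar (t (Suc m)) \<otimes>\<^bsub>A\<^esub> h = \<theta> h \<otimes>\<^bsub>A\<^esub> scalar (\<Prod>j = 2..m. t j ^ k j)"
  by (auto simp: defect_z A_closed dan_scalar_def dest: inj_onD[OF inj_on_emb])

end

theorem proposition6p3:
  fixes d m :: nat and k :: "nat \<Rightarrow> nat"
    and s :: "nat \<Rightarrow> 'k::{alg_closed_field, field_char_0} mpoly" and P :: "'k mpoly"
    and D \<delta> \<theta> :: "'k mpoly set \<Rightarrow> 'k mpoly set" and h y1 z :: "'k mpoly set"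
    and \<sigma> :: "nat \<Rightarrow> nat" and t :: "nat \<Rightarrow> 'k"
  assumes "d \<ge> 2" and "m \<ge> 2" and "\<And>i. i \<in> {2..m} \<Longrightarrow> k i \<ge> 2"
    and "\<And>j. j < d \<Longrightarrow> s j \<in> mpolys {2..m}" and "s (d - 1) = 0"
    and "P = dan_poly d m s"
    and "A = dan_ring m k P" and "\<kappa> = dan_scalar m k P"
    and "y1 = dan_class m k P (mvar 1)" and "z = dan_class m k P (mvar (Suc m))"
    and "is_canonical_derivation m k P D"
    and "h \<in> dan_class m k P ` mpolys {2..m}"
    and "\<delta> = (\<lambda>a. h \<otimes>\<^bsub>A\<^esub> D a)"
    and "(\<sigma>, t) \<in> canonical_group m k P"
    and "\<theta> = canonical_aut m k P (\<sigma>, t)"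
  defines "stmt_a \<equiv> \<delta> (\<theta> y1) = \<theta> (\<delta> y1)"
    and "stmt_b \<equiv> \<kappa> (t (Suc m)) \<otimes>\<^bsub>A\<^esub> h = \<theta> h \<otimes>\<^bsub>A\<^esub> \<kappa> (\<Prod>j = 2..m. t j ^ k j)"
    and "stmt_c \<equiv> \<delta> (\<theta> z) = \<theta> (\<delta> z)"
    and "stmt_d \<equiv> \<theta> \<in> derivation_auts A \<kappa> \<delta>"
    and "stmt_b' \<equiv> t (Suc m) = (\<Prod>j = 2..m. t j ^ k j)"
  shows "(stmt_a \<longleftrightarrow> stmt_b) \<and> (stmt_b \<longleftrightarrow> stmt_c) \<and> (stmt_c \<longleftrightarrow> stmt_d) \<and>
    (\<theta> h = h \<and> h \<noteq> \<zero>\<^bsub>A\<^esub> \<longrightarrow> (stmt_b \<longleftrightarrow> stmt_b')) \<and>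
    (h \<in> \<kappa> ` (UNIV - {0}) \<longrightarrow> \<theta> h = h \<and> (stmt_b \<longleftrightarrow> stmt_b'))"
proof -
  interpret danielewski_derivation m d k s P \<sigma> t D h
  proof unfold_locales
    show "1 \<le> k i" if "i \<in> {2..m}" for i
      using assms(3)[OF that] by simp
    show "h \<in> carrier (dan_ring m k P)"
      using assms(12) mpolys_mono[of "{2..m}" "{1..Suc m}"]
      by (auto simp: dan_ring_def dan_class_def FactRing_def A_RCOSETS_def' mpoly_ring_def)
  qed (use assms in auto)
  note eqs = assms(7-10,13,15)
  have z_R: "mvar 1 \<in> R" "mvar (Suc m) \<in> R"
    by (auto intro!: mpolys_var)
  \<comment> \<open>Statements (b), (c) and (d) all reduce to \<open>E(z) = 0\<close>, and (a) to
    \<open>E(y_1) = 0\<close>; \<open>defect_y1_iff\<close> joins the two.\<close>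
  have b: "stmt_b \<longleftrightarrow> defect (mvar (Suc m)) = 0"
    by (simp add: stmt_b_def defect_z_eq_0_iff eqs)
  have a: "stmt_a \<longleftrightarrow> defect (mvar 1) = 0"
    using z_R by (simp add: stmt_a_def defect_eq_0_iff eqs)
  have c: "stmt_c \<longleftrightarrow> defect (mvar (Suc m)) = 0"
    using z_R by (simp add: stmt_c_def defect_eq_0_iff eqs)
  have d: "stmt_d \<longleftrightarrow> defect (mvar (Suc m)) = 0"
    using \<theta>_alg_auts by (simp add: stmt_d_def derivation_auts_def commutes_iff eqs)
  have b': "stmt_b \<longleftrightarrow> stmt_b'" if "\<theta> h = h" "h \<noteq> \<zero>\<^bsub>A\<^esub>"
    using that scalar_cancel[of h] by (simp add: stmt_b_def stmt_b'_def eqs)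
  \<comment> \<open>A nonzero scalar is fixed by \<theta> and is nonzero in the coordinate ring, so
    the last claim is a case of the previous one.\<close>
  have const: "\<theta> h = h \<and> h \<noteq> \<zero>\<^bsub>A\<^esub>" if h_scalar: "h \<in> \<kappa> ` (UNIV - {0})"
  proof -
    obtain e where e: "h = \<kappa> e" "e \<in> UNIV - {0}"
      using h_scalar by (rule imageE)
    have h: "h = cls (mconst e)"
      using e(1) by (simp add: eqs dan_scalar_def)
    with e(2) have "emb h \<noteq> emb (cls 0)"
      by (simp add: emb_cls)
    then show ?thesis
      using h by (auto simp: \<theta>_const cls_0 eqs)
  qed
  show ?thesis
    using a b c d defect_y1_iff b' const by blast
qed

end
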